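(* Assume treatment ignorability, latent principal ignorability and the odds-ratio (non-monotonicity) assumption (all stated in the context). Let $z_1\ne z_2$, $s\in\mathcal S_{z_1,d_1}\cap\mathcal S_{z_2,d_2}$ and $c_0\in[0,1)$. Suppose the value of $\mu_{z_1,z_2,s}(x_1,x_2)$ under mean principal ignorability, $m_{z_1,z_2,d_1,d_2}(x_1,x_2)$, exceeds $c_0$, and the worst-case lower bound satisfies $L^{\mathrm{GM}}_{z_1,z_2,s}(x_1,x_2)\le c_0$. Then there exist three unique critical falsification thresholds $$1<\gamma_{SU,s}^*(x_1,x_2)<\gamma_{UY,s}^*(x_1,x_2)<\Gamma_s^*(x_1,x_2)<\infty,$$ defined as the roots in $(1,\infty)$ of, respectively, $$\lim_{\rho_{UY}\to\infty}L_{z_1,z_2,s}(x_1,x_2,\gamma_{SU,s}^*,\rho_{UY})=c_0,\qquad\lim_{\rho_{SU}\to\infty}L_{z_1,z_2,s}(x_1,x_2,\rho_{SU},\gamma_{UY,s}^* )=c_0,\qquad L_{z_1,z_2,s}(x_1,x_2,\Gamma_s^*,\Gamma_s^* )=c_0,$$ such that, to nullify $\mu_{z_1,z_2,s}(x_1,x_2)$ (i.e. to have $L_{z_1,z_2,s}(x_1,x_2)\le c_0$), the unmeasured confounding must simultaneously satisfy $$\max\{\mathrm{RR}_{SU}^{z_1,d_1}(x_1),\mathrm{RR}_{SU}^{z_2,d_2}(x_2)\}\ge\gamma_{SU,s}^*(x_1,x_2),\qquad\mathrm{RR}_{UY}^{z_1,z_2}(x_1,x_2)\ge\gamma_{UY,s}^*(x_1,x_2),$$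 $$\max\{\mathrm{RR}_{SU}^{z_1,d_1}(x_1),\mathrm{RR}_{SU}^{z_2,d_2}(x_2),\mathrm{RR}_{UY}^{z_1,z_2}(x_1,x_2)\}\ge\Gamma_s^*(x_1,x_2).$$
   Context: Setup. $Z\in\{0,1\}$ is a treatment, $D(z)\in\{0,1\}$ and $Y(z)\in\mathcal Y$ are the potential intermediate and final outcomes under $Z=z$ ($\mathcal Y=[0,1]$, or a general outcome space since $h$ below is bounded), $X\in\mathcal X$ are baseline covariates and $U$ is a set of unmeasured baseline confounders; neither $X$ nor $U$ is affected by $Z$ ($U$ is written as categorical; for general $U$ probability ratios are replaced by Radon–Nikodym derivatives). Observed: $D=ZD(1)+(1-Z)D(0)$, $Y=ZY(1)+(1-Z)Y(0)$ (SUTVA). The principal stratum is $S=(D(1),D(0))\in\{11,10,01,00\}$; $e_s(x)=\mathbb P(S=s\mid X=x)$, $p_z(x)=\mathbb P(D=1\mid Z=z,X=x)$. Subscripts $1,2$ denote two independent replicates of all variables from the same data-generating process. $h:\mathcal Y\times\mathcal Y\to[0,1]$ is a (nonlinear) contrast function. Assumptions. Treatment ignorability: $Z\perp\{D(0),D(1),Y(0),Y(1)\}\mid X$. Latent principal ignorability: $Y(z)\perp S\mid X,U$ for $z\in\{0,1\}$. Odds-ratio (non-monotonicity) assumption: there is a known function $\theta:\mathcal X\to[0,\infty]$ with $\theta(x)=e_{11}(x)e_{00}(x)/\{e_{10}(x)e_{01}(x)\}$. Since $p_1=e_{11}+e_{10}$, $p_0=e_{11}+e_{01}$ and $\sum_s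 e_s=1$, the $e_s(x)$ are then determined by $p_1(x),p_0(x),\theta(x)$. Cells. $\mathcal S_{1,1}=\{10,11\}$, $\mathcal S_{0,0}=\{10,00\}$, $\mathcal S_{1,0}=\{00,01\}$, $\mathcal S_{0,1}=\{11,01\}$. For $s\in\mathcal S_{z,d}$: $w_{z,s}(x)=e_s(x)/p_z(x)$ if $d=1$ and $w_{z,s}(x)=e_s(x)/\{1-p_z(x)\}$ if $d=0$. Estimand and observed mean. $\mu_{z_1,z_2,s}(x_1,x_2)=\mathbb E[h\{Y_1(z_1),Y_2(z_2)\}\mid S_1=S_2=s,X_1=x_1,X_2=x_2]$; $m_{z_1,z_2,d_1,d_2}(x_1,x_2)=\mathbb E[h(Y_1,Y_2)\mid Z_j=z_j,D_j=d_j,X_j=x_j,\ j=1,2]$. Sensitivity parameters. $\mathrm{RR}_{SU}^{z,d}(x)\in[1,\infty)$ is the maximum of $\mathbb P(U=u\mid S=s,X=x)/\mathbb P(U=u\mid S=s',X=x)$ over $u$ and over ordered pairs $s\ne s'$ in $\mathcal S_{z,d}$. $\mathrm{RR}_{UY}^{z_1,z_2}(x_1,x_2)\in[1,\infty)$ is the ratio of $\max_{u_1,u_2}$ to $\min_{u_1,u_2}$ of $\mathbb E[h\{Y_1(z_1),Y_2(z_2)\}\mid X_j=x_j,U_j=u_j,\ j=1,2]$. Lower bound. Write $w_j=w_{z_j,s}(x_j)$ and $m=m_{z_1,z_2,d_1,d_2}(x_1,x_2)$. For selection relative risks $R_1,R_2\ge1$ and outcome relative risk $R_Y\ge1$ put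 $b_j=\frac{R_jR_Y}{R_j+R_Y-1}$ ($j=1,2$), $b_{12}=\frac{R_1R_2R_Y}{R_1R_2+R_Y-1}$, $A=w_1w_2+(1-w_1)w_2b_1+w_1(1-w_2)b_2+(1-w_1)(1-w_2)b_{12}$, $B=w_1w_2+(1-w_1)w_2/b_1+w_1(1-w_2)/b_2+(1-w_1)(1-w_2)/b_{12}$, and consider $\max\{m/A,\,1-(1-m)/B\}$. This quantity is denoted $L_{z_1,z_2,s}(x_1,x_2)$ when $R_j=\mathrm{RR}_{SU}^{z_j,d_j}(x_j)$ and $R_Y=\mathrm{RR}_{UY}^{z_1,z_2}(x_1,x_2)$, and $L_{z_1,z_2,s}(x_1,x_2,\rho_{SU},\rho_{UY})$ when $R_1=R_2=\rho_{SU}$ and $R_Y=\rho_{UY}$. The worst-case lower bound is $L^{\mathrm{GM}}_{z_1,z_2,s}(x_1,x_2)=\max\{0,\,1-(1-m)/(w_1w_2)\}$. Mean principal ignorability is the condition under which $\mu_{z_1,z_2,s}(x_1,x_2)=m_{z_1,z_2,d_1,d_2}(x_1,x_2)$.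
   Formalization: The worst-case bound is assumed strictly below c_0 (at equality, so whenever c_0=0, no finite roots exist); P(Z=z_j|X=x_j) and both strata of each cell have positive probability (a weight 1 would give γ_SU=γ_UY); U is categorical (countable). *)

theory Defs
  imports "HOL-Probability.Probability"
begin

section \<open>Data-generating process\<close>

text \<open>
  Binary variables are Booleans, with \<^term>\<open>True\<close> for 1.  The single covariate \<open>covar\<close> and the
  single confounder \<open>confounder\<close> are functions of the unit only, so they are not affected by
  treatment.  \<open>given x\<close> is the conditional law \<open>P(. | X = x)\<close> of a unit, which need not satisfy
  \<open>P(X = x) > 0\<close>.
\<close>

record ('w, 'x, 'y, 'u) dgp =
  law :: "'w measure"
  cov_space :: "'x measure"
  out_space :: "'y measure"
  covar :: "'w \<Rightarrow> 'x"
  confounder :: "'w \<Rightarrow> 'u"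
  treat :: "'w \<Rightarrow> bool"
  pot_D :: "bool \<Rightarrow> 'w \<Rightarrow> bool"
  pot_Y :: "bool \<Rightarrow> 'w \<Rightarrow> 'y"
  given :: "'x \<Rightarrow> 'w measure"

text \<open>
  The last two clauses say that \<open>given\<close> is a regular version of the conditional law given the
  covariate.  All pointwise quantities below refer to this version.
\<close>

definition valid_dgp :: "('w, 'x, 'y, 'u::countable) dgp \<Rightarrow> bool" where
  "valid_dgp M \<longleftrightarrow>
     prob_space (law M) \<and>
     covar M \<in> law M \<rightarrow>\<^sub>M cov_space M \<and>
     confounder M \<in> law M \<rightarrow>\<^sub>M count_space UNIV \<and>
     treat M \<in> law M \<rightarrow>\<^sub>M count_space UNIV \<and>
     (\<forall>z. pot_D M z \<in> law M \<rightarrow>\<^sub>M count_space UNIV) \<and>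
     (\<forall>z. pot_Y M z \<in> law M \<rightarrow>\<^sub>M out_space M) \<and>
     given M \<in> cov_space M \<rightarrow>\<^sub>M prob_algebra (law M) \<and>
     (\<forall>A\<in>sets (law M). \<forall>B\<in>sets (cov_space M).
        emeasure (law M) (A \<inter> covar M -` B) =
        (\<integral>\<^sup>+x\<in>B. emeasure (given M x) A \<partial>distr (law M) (cov_space M) (covar M)))"

definition obs_D :: "('w, 'x, 'y, 'u) dgp \<Rightarrow> 'w \<Rightarrow> bool" where
  "obs_D M \<omega> = pot_D M (treat M \<omega>) \<omega>"

definition obs_Y :: "('w, 'x, 'y, 'u) dgp \<Rightarrow> 'w \<Rightarrow> 'y" where
  "obs_Y M \<omega> = pot_Y M (treat M \<omega>) \<omega>"

text \<open>The stratum is \<open>(D(1), D(0))\<close>, so the stratum 10 is \<^term>\<open>(True, False)\<close>.\<close>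

type_synonym stratum = "bool \<times> bool"

definition stratum :: "('w, 'x, 'y, 'u) dgp \<Rightarrow> 'w \<Rightarrow> stratum" where
  "stratum M \<omega> = (pot_D M True \<omega>, pot_D M False \<omega>)"

fun cell :: "bool \<Rightarrow> bool \<Rightarrow> stratum set" where
  "cell True True = {(True, False), (True, True)}"
| "cell False False = {(True, False), (False, False)}"
| "cell True False = {(False, False), (False, True)}"
| "cell False True = {(True, True), (False, True)}"

definition stratum_prob :: "('w, 'x, 'y, 'u) dgp \<Rightarrow> stratum \<Rightarrow> 'x \<Rightarrow> real" where
  "stratum_prob M s x = \<P>(\<omega> in given M x. stratum M \<omega> = s)"

definition D_prob :: "('w, 'x, 'y, 'u) dgp \<Rightarrow> bool \<Rightarrow> 'x \<Rightarrow> real" where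
  "D_prob M z x = \<P>(\<omega> in given M x. obs_D M \<omega> \<bar> treat M \<omega> = z)"

definition weight :: "('w, 'x, 'y, 'u) dgp \<Rightarrow> bool \<Rightarrow> bool \<Rightarrow> stratum \<Rightarrow> 'x \<Rightarrow> real" where
  "weight M z d s x =
     (if d then stratum_prob M s x / D_prob M z x
      else stratum_prob M s x / (1 - D_prob M z x))"


section \<open>Identification assumptions\<close>

text \<open>
  Independence conditional on \<open>X\<close> is independence under \<open>given x\<close>, for every \<open>x\<close>; independence
  conditional on \<open>X, U\<close> is independence under \<open>given x\<close> conditioned further on the event
  \<open>U = u\<close>, for every \<open>u\<close> of positive conditional probability.
\<close>

definition treatment_ignorability :: "('w, 'x, 'y, 'u) dgp \<Rightarrow> bool" where
  "treatment_ignorability M \<longleftrightarrow>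
     (\<forall>x\<in>space (cov_space M).
        prob_space.indep_set (given M x)
          {treat M -` A \<inter> space (given M x) | A. True}
          {(\<lambda>\<omega>. (pot_D M False \<omega>, pot_D M True \<omega>, pot_Y M False \<omega>, pot_Y M True \<omega>)) -` B
             \<inter> space (given M x) | B.
             B \<in> sets (count_space UNIV \<Otimes>\<^sub>M count_space UNIV \<Otimes>\<^sub>M out_space M \<Otimes>\<^sub>M out_space M)})"

definition conf_support :: "('w, 'x, 'y, 'u) dgp \<Rightarrow> 'x \<Rightarrow> 'u set" where
  "conf_support M x = {u. \<P>(\<omega> in given M x. confounder M \<omega> = u) > 0}"

definition given_conf :: "('w, 'x, 'y, 'u) dgp \<Rightarrow> 'x \<Rightarrow> 'u \<Rightarrow> 'w measure" where
  "given_conf M x u =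
     uniform_measure (given M x) {\<omega> \<in> space (given M x). confounder M \<omega> = u}"

definition latent_principal_ignorability :: "('w, 'x, 'y, 'u) dgp \<Rightarrow> bool" where
  "latent_principal_ignorability M \<longleftrightarrow>
     (\<forall>z. \<forall>x\<in>space (cov_space M). \<forall>u\<in>conf_support M x.
        prob_space.indep_set (given_conf M x u)
          {pot_Y M z -` A \<inter> space (given_conf M x u) | A. A \<in> sets (out_space M)}
          {stratum M -` B \<inter> space (given_conf M x u) | B. True})"

text \<open>In \<^typ>\<open>ennreal\<close>, \<open>a / 0 = \<infinity>\<close> for \<open>a > 0\<close>; this is the monotonicity case \<open>\<theta> = \<infinity>\<close>.
  The undefined ratio \<open>0 / 0\<close> is 0 there.\<close>

definition odds_ratio_assumption ::
    "('w, 'x, 'y, 'u) dgp \<Rightarrow> ('x \<Rightarrow> ennreal) \<Rightarrow> bool" where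
  "odds_ratio_assumption M \<theta> \<longleftrightarrow>
     (\<forall>x\<in>space (cov_space M).
        \<theta> x = ennreal (stratum_prob M (True, True) x * stratum_prob M (False, False) x)
               / ennreal (stratum_prob M (True, False) x * stratum_prob M (False, True) x))"


section \<open>Pairs of independent replicates\<close>

text \<open>
  Given \<open>X\<^sub>1 = x1\<close> and \<open>X\<^sub>2 = x2\<close>, two independent replicates have the product of the two
  conditional laws.
\<close>

definition pair_given :: "('w, 'x, 'y, 'u) dgp \<Rightarrow> 'x \<Rightarrow> 'x \<Rightarrow> ('w \<times> 'w) measure" where
  "pair_given M x1 x2 = given M x1 \<Otimes>\<^sub>M given M x2"

definition cond_mean :: "'a measure \<Rightarrow> ('a \<Rightarrow> real) \<Rightarrow> ('a \<Rightarrow> bool) \<Rightarrow> real" where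
  "cond_mean P f E = (\<integral>\<omega>. f \<omega> \<partial>uniform_measure P {\<omega> \<in> space P. E \<omega>})"

definition contrast :: "('w, 'x, 'y, 'u) dgp \<Rightarrow> ('y \<Rightarrow> 'y \<Rightarrow> real) \<Rightarrow> bool" where
  "contrast M h \<longleftrightarrow>
     (\<lambda>(a, b). h a b) \<in> borel_measurable (out_space M \<Otimes>\<^sub>M out_space M) \<and>
     (\<forall>a\<in>space (out_space M). \<forall>b\<in>space (out_space M). h a b \<in> {0..1})"

definition obs_mean ::
    "('w, 'x, 'y, 'u) dgp \<Rightarrow> ('y \<Rightarrow> 'y \<Rightarrow> real) \<Rightarrow> bool \<Rightarrow> bool \<Rightarrow> bool \<Rightarrow> bool
       \<Rightarrow> 'x \<Rightarrow> 'x \<Rightarrow> real" where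
  "obs_mean M h z1 z2 d1 d2 x1 x2 =
     cond_mean (pair_given M x1 x2) (\<lambda>(\<omega>1, \<omega>2). h (obs_Y M \<omega>1) (obs_Y M \<omega>2))
       (\<lambda>(\<omega>1, \<omega>2). treat M \<omega>1 = z1 \<and> obs_D M \<omega>1 = d1 \<and> treat M \<omega>2 = z2 \<and> obs_D M \<omega>2 = d2)"


section \<open>Sensitivity parameters\<close>

text \<open>
  The confounder is discrete, possibly with infinitely many categories, so suprema and infima
  stand for the maxima and minima.  In \<^typ>\<open>ennreal\<close>, \<open>a / 0 = \<infinity>\<close> for \<open>a > 0\<close> and
  \<open>0 / 0 = 0\<close>: finiteness of \<open>RR_SU\<close> forces a common support of the confounder across the cell,
  and categories of probability zero do not contribute.
\<close>

definition RR_SU :: "('w, 'x, 'y, 'u) dgp \<Rightarrow> bool \<Rightarrow> bool \<Rightarrow> 'x \<Rightarrow> ennreal" where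
  "RR_SU M z d x =
     (SUP (s, s', u) \<in> {(s, s', u). s \<in> cell z d \<and> s' \<in> cell z d \<and> s \<noteq> s'}.
        ennreal (\<P>(\<omega> in given M x. confounder M \<omega> = u \<bar> stratum M \<omega> = s))
        / ennreal (\<P>(\<omega> in given M x. confounder M \<omega> = u \<bar> stratum M \<omega> = s')))"

definition latent_mean ::
    "('w, 'x, 'y, 'u) dgp \<Rightarrow> ('y \<Rightarrow> 'y \<Rightarrow> real) \<Rightarrow> bool \<Rightarrow> bool
       \<Rightarrow> 'x \<Rightarrow> 'x \<Rightarrow> 'u \<Rightarrow> 'u \<Rightarrow> real" where
  "latent_mean M h z1 z2 x1 x2 u1 u2 =
     cond_mean (pair_given M x1 x2) (\<lambda>(\<omega>1, \<omega>2). h (pot_Y M z1 \<omega>1) (pot_Y M z2 \<omega>2))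
       (\<lambda>(\<omega>1, \<omega>2). confounder M \<omega>1 = u1 \<and> confounder M \<omega>2 = u2)"

definition RR_UY ::
    "('w, 'x, 'y, 'u) dgp \<Rightarrow> ('y \<Rightarrow> 'y \<Rightarrow> real) \<Rightarrow> bool \<Rightarrow> bool \<Rightarrow> 'x \<Rightarrow> 'x \<Rightarrow> ennreal" where
  "RR_UY M h z1 z2 x1 x2 =
     (SUP (u1, u2) \<in> conf_support M x1 \<times> conf_support M x2.
        ennreal (latent_mean M h z1 z2 x1 x2 u1 u2))
     / (INF (u1, u2) \<in> conf_support M x1 \<times> conf_support M x2.
        ennreal (latent_mean M h z1 z2 x1 x2 u1 u2))"


section \<open>Lower bounds\<close>

definition bias :: "real \<Rightarrow> real \<Rightarrow> real" where
  "bias R RY = R * RY / (R + RY - 1)"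

text \<open>\<open>b\<^sub>1\<close>, \<open>b\<^sub>2\<close> and \<open>b\<^sub>1\<^sub>2\<close> are \<open>bias R1 RY\<close>, \<open>bias R2 RY\<close> and \<open>bias (R1 * R2) RY\<close>.\<close>

definition A_factor :: "real \<Rightarrow> real \<Rightarrow> real \<Rightarrow> real \<Rightarrow> real \<Rightarrow> real" where
  "A_factor w1 w2 R1 R2 RY =
     w1 * w2 + (1 - w1) * w2 * bias R1 RY + w1 * (1 - w2) * bias R2 RY
     + (1 - w1) * (1 - w2) * bias (R1 * R2) RY"

definition B_factor :: "real \<Rightarrow> real \<Rightarrow> real \<Rightarrow> real \<Rightarrow> real \<Rightarrow> real" where
  "B_factor w1 w2 R1 R2 RY =
     w1 * w2 + (1 - w1) * w2 / bias R1 RY + w1 * (1 - w2) / bias R2 RY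
     + (1 - w1) * (1 - w2) / bias (R1 * R2) RY"

definition lower_bound :: "real \<Rightarrow> real \<Rightarrow> real \<Rightarrow> real \<Rightarrow> real \<Rightarrow> real \<Rightarrow> real" where
  "lower_bound mm w1 w2 R1 R2 RY =
     max (mm / A_factor w1 w2 R1 R2 RY) (1 - (1 - mm) / B_factor w1 w2 R1 R2 RY)"

text \<open>The cells \<open>d1, d2\<close> are arguments here; they are determined by \<open>s \<in> cell z1 d1 \<inter> cell z2 d2\<close>.\<close>

definition L_bound ::
    "('w, 'x, 'y, 'u) dgp \<Rightarrow> ('y \<Rightarrow> 'y \<Rightarrow> real) \<Rightarrow> bool \<Rightarrow> bool \<Rightarrow> bool \<Rightarrow> bool \<Rightarrow> stratum
       \<Rightarrow> 'x \<Rightarrow> 'x \<Rightarrow> real" where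
  "L_bound M h z1 z2 d1 d2 s x1 x2 =
     lower_bound (obs_mean M h z1 z2 d1 d2 x1 x2) (weight M z1 d1 s x1) (weight M z2 d2 s x2)
       (enn2real (RR_SU M z1 d1 x1)) (enn2real (RR_SU M z2 d2 x2))
       (enn2real (RR_UY M h z1 z2 x1 x2))"

definition L_param ::
    "('w, 'x, 'y, 'u) dgp \<Rightarrow> ('y \<Rightarrow> 'y \<Rightarrow> real) \<Rightarrow> bool \<Rightarrow> bool \<Rightarrow> bool \<Rightarrow> bool \<Rightarrow> stratum
       \<Rightarrow> 'x \<Rightarrow> 'x \<Rightarrow> real \<Rightarrow> real \<Rightarrow> real" where
  "L_param M h z1 z2 d1 d2 s x1 x2 \<rho>SU \<rho>UY =
     lower_bound (obs_mean M h z1 z2 d1 d2 x1 x2) (weight M z1 d1 s x1) (weight M z2 d2 s x2)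
       \<rho>SU \<rho>SU \<rho>UY"

text \<open>
  For finite parameters \<open>A_factor\<close> is finite and, for weights below 1, \<open>B_factor\<close> exceeds \<open>w1 * w2\<close>.
  So if \<open>0 < obs_mean < 1\<close>, the bounds above and their limits in one parameter lie strictly above
  \<open>L_GM\<close>.  Roots of \<open>L_param = c0\<close> with finite parameters therefore require the strict inequality
  \<open>L_GM < c0\<close>, and in particular \<open>c0 > 0\<close>.
\<close>

definition L_GM ::
    "('w, 'x, 'y, 'u) dgp \<Rightarrow> ('y \<Rightarrow> 'y \<Rightarrow> real) \<Rightarrow> bool \<Rightarrow> bool \<Rightarrow> bool \<Rightarrow> bool \<Rightarrow> stratum
       \<Rightarrow> 'x \<Rightarrow> 'x \<Rightarrow> real" where
  "L_GM M h z1 z2 d1 d2 s x1 x2 =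
     max 0 (1 - (1 - obs_mean M h z1 z2 d1 d2 x1 x2)
              / (weight M z1 d1 s x1 * weight M z2 d2 s x2))"

text \<open>
  The events conditioned on at one covariate value: \<open>Z = z\<close> (in \<open>D_prob\<close> and \<open>obs_mean\<close>) and
  both strata of the cell (in \<open>RR_SU\<close>).  Their positivity makes the conditional probabilities
  meaningful; under treatment ignorability it also puts the weights strictly between 0 and 1.
\<close>

definition cell_positivity :: "('w, 'x, 'y, 'u) dgp \<Rightarrow> bool \<Rightarrow> bool \<Rightarrow> 'x \<Rightarrow> bool" where
  "cell_positivity M z d x \<longleftrightarrow>
     \<P>(\<omega> in given M x. treat M \<omega> = z) > 0 \<and> (\<forall>s'\<in>cell z d. stratum_prob M s' x > 0)"

end

theory Submission
  imports Defs "HOL-Real_Asymp.Real_Asymp"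
begin

text \<open>
  The lower bound is strictly decreasing in the bias factors \<open>(b\<^sub>1, b\<^sub>2, b\<^sub>1\<^sub>2)\<close>; it equals \<open>m\<close> at
  \<open>(1, 1, 1)\<close> and tends to the worst-case bound as they go to infinity, so it crosses \<open>c\<^sub>0\<close> exactly
  once along each of the curves \<open>(g, g, g\<^sup>2)\<close> (limit in the outcome risk), \<open>(g, g, g)\<close> (limit in
  the selection risk) and \<open>(bias g g, bias g g, bias g\<^sup>2 g)\<close>.  For \<open>g > 1\<close> each curve dominates
  the next one in the third coordinate, strictly, which orders the roots.  Since \<open>bias R RY\<close> is
  increasing and at most \<open>min R RY\<close>, each curve, taken at the corresponding maximum of the actual
  risks, also dominates their bias factors, which gives the necessary conditions.
\<close>

section \<open>The lower bound as a function of the bias factors\<close>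

text \<open>Freeing the three bias factors from the risks lets one function describe both the bound
  and its one-parameter limits, in which a factor such as \<open>g * g\<close> is itself only a
  limit of \<open>bias\<close>.\<close>

definition bound_at :: "real \<Rightarrow> real \<Rightarrow> real \<Rightarrow> real \<Rightarrow> real \<Rightarrow> real \<Rightarrow> real" where
  "bound_at m w1 w2 b1 b2 b12 =
     max (m / (w1 * w2 + (1 - w1) * w2 * b1 + w1 * (1 - w2) * b2 + (1 - w1) * (1 - w2) * b12))
       (1 - (1 - m) / (w1 * w2 + (1 - w1) * w2 / b1 + w1 * (1 - w2) / b2 + (1 - w1) * (1 - w2) / b12))"

lemma lower_bound_eq_bound_at:
  "lower_bound m w1 w2 R1 R2 RY = bound_at m w1 w2 (bias R1 RY) (bias R2 RY) (bias (R1 * R2) RY)"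
  by (simp add: lower_bound_def bound_at_def A_factor_def B_factor_def)

text \<open>The four products of weights expand \<open>(w1 + (1 - w1)) * (w2 + (1 - w2))\<close>, so
  both denominators are 1.\<close>

lemma bound_at_1: "bound_at m w1 w2 1 1 1 = m"
proof -
  have "w1 * w2 + (1 - w1) * w2 + w1 * (1 - w2) + (1 - w1) * (1 - w2) = 1"
    by (simp add: algebra_simps)
  then show ?thesis
    by (simp add: bound_at_def)
qed

text \<open>Raising a factor raises the first denominator and lowers the second; with
  \<open>0 < m < 1\<close> both branches of the maximum drop strictly. Strictness is asked of the
  third factor only, because the curves of the first two thresholds agree in the other two.\<close>

lemma bound_at_strict_antimono:
  assumes "0 < m" "m < 1" "w1 \<in> {0<..<1}" "w2 \<in> {0<..<1}"
    and "0 < b1" "b1 \<le> c1" "0 < b2" "b2 \<le> c2" "0 < b12" "b12 < c12"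
  shows "bound_at m w1 w2 c1 c2 c12 < bound_at m w1 w2 b1 b2 b12"
proof -
  define p q r t where "p = w1 * w2" and "q = (1 - w1) * w2" and "r = w1 * (1 - w2)"
    and "t = (1 - w1) * (1 - w2)"
  note defs = p_def q_def r_def t_def
  have pos: "p > 0" "q > 0" "r > 0" "t > 0"
    using assms by (simp_all add: defs)
  have "p + q * b1 + r * b2 + t * b12 < p + q * c1 + r * c2 + t * c12"
    using assms pos by (intro add_le_less_mono add_mono mult_left_mono mult_strict_left_mono) auto
  moreover have "0 < p + q * b1 + r * b2 + t * b12"
    using assms pos by (simp add: add_pos_pos)
  ultimately have 1: "m / (p + q * c1 + r * c2 + t * c12) < m / (p + q * b1 + r * b2 + t * b12)"
    using \<open>0 < m\<close> by (simp add: divide_strict_left_mono)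
  have "p + q / c1 + r / c2 + t / c12 < p + q / b1 + r / b2 + t / b12"
    using assms pos
    by (intro add_le_less_mono add_mono divide_left_mono divide_strict_left_mono) auto
  moreover have "0 < p + q / c1 + r / c2 + t / c12"
    using assms pos by (simp add: add_pos_pos)
  ultimately have 2: "(1 - m) / (p + q / b1 + r / b2 + t / b12) < (1 - m) / (p + q / c1 + r / c2 + t / c12)"
    using \<open>m < 1\<close> by (simp add: divide_strict_left_mono)
  from 1 2 show ?thesis
    unfolding bound_at_def defs[symmetric] by linarith
qed

lemma bound_at_antimono:
  assumes "0 < m" "m < 1" "w1 \<in> {0<..<1}" "w2 \<in> {0<..<1}"
    and "0 < b1" "b1 \<le> c1" "0 < b2" "b2 \<le> c2" "0 < b12" "b12 \<le> c12"
  shows "bound_at m w1 w2 c1 c2 c12 \<le> bound_at m w1 w2 b1 b2 b12"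
proof -
  define p q r t where "p = w1 * w2" and "q = (1 - w1) * w2" and "r = w1 * (1 - w2)"
    and "t = (1 - w1) * (1 - w2)"
  note defs = p_def q_def r_def t_def
  have pos: "p > 0" "q > 0" "r > 0" "t > 0"
    using assms by (simp_all add: defs)
  have "p + q * b1 + r * b2 + t * b12 \<le> p + q * c1 + r * c2 + t * c12"
    using assms pos by (intro add_mono mult_left_mono) auto
  moreover have "0 < p + q * b1 + r * b2 + t * b12"
    using assms pos by (simp add: add_pos_pos)
  ultimately have 1: "m / (p + q * c1 + r * c2 + t * c12) \<le> m / (p + q * b1 + r * b2 + t * b12)"
    using \<open>0 < m\<close> by (simp add: divide_left_mono)
  have "p + q / c1 + r / c2 + t / c12 \<le> p + q / b1 + r / b2 + t / b12"
    using assms pos by (intro add_mono divide_left_mono) auto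
  moreover have "0 < p + q / c1 + r / c2 + t / c12"
    using assms pos by (simp add: add_pos_pos)
  ultimately have 2: "(1 - m) / (p + q / b1 + r / b2 + t / b12) \<le> (1 - m) / (p + q / c1 + r / c2 + t / c12)"
    using \<open>m < 1\<close> by (simp add: divide_left_mono)
  from 1 2 show ?thesis
    unfolding bound_at_def defs[symmetric] by linarith
qed

lemma bound_at_tendsto:
  assumes "w1 \<in> {0<..<1}" "w2 \<in> {0<..<1}" "0 < b1" "0 < b2" "0 < b12"
    and "(f1 \<longlongrightarrow> b1) F" "(f2 \<longlongrightarrow> b2) F" "(f12 \<longlongrightarrow> b12) F"
  shows "((\<lambda>x. bound_at m w1 w2 (f1 x) (f2 x) (f12 x)) \<longlongrightarrow> bound_at m w1 w2 b1 b2 b12) F"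
proof -
  have "w1 * w2 + (1 - w1) * w2 * b1 + w1 * (1 - w2) * b2 + (1 - w1) * (1 - w2) * b12 > 0"
    "w1 * w2 + (1 - w1) * w2 / b1 + w1 * (1 - w2) / b2 + (1 - w1) * (1 - w2) / b12 > 0"
    using assms(1-5) by (simp_all add: add_pos_pos)
  then show ?thesis
    unfolding bound_at_def
    using assms by (intro tendsto_intros) auto
qed

text \<open>The first denominator diverges and the second collapses to \<open>w1 * w2\<close>, which
  leaves the worst-case bound.\<close>

lemma bound_at_tendsto_at_top:
  assumes "w1 \<in> {0<..<1}" "w2 \<in> {0<..<1}"
    and "filterlim f1 at_top F" "filterlim f2 at_top F" "filterlim f12 at_top F"
  shows "((\<lambda>x. bound_at m w1 w2 (f1 x) (f2 x) (f12 x)) \<longlongrightarrow> max 0 (1 - (1 - m) / (w1 * w2))) F"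
proof -
  define p q r t where "p = w1 * w2" and "q = (1 - w1) * w2" and "r = w1 * (1 - w2)"
    and "t = (1 - w1) * (1 - w2)"
  note defs = p_def q_def r_def t_def
  have pos: "p > 0" "q > 0" "r > 0" "t > 0"
    using assms(1,2) by (simp_all add: defs)
  have inf: "filterlim f1 at_infinity F" "filterlim f2 at_infinity F" "filterlim f12 at_infinity F"
    using assms(3-5) by (auto intro: filterlim_at_top_imp_at_infinity)
  \<comment> \<open>Bracketing to the right isolates the constant \<open>p\<close> as the convergent
    summand in front of a divergent one; \<open>add.assoc\<close> reconciles this form with
    \<open>bound_at\<close> at the end.\<close>
  have "filterlim (\<lambda>x. p + (q * f1 x + (r * f2 x + t * f12 x))) at_top F"
    using pos assms(3-5)
    by (intro filterlim_tendsto_add_at_top[OF tendsto_const] filterlim_at_top_add_at_top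
        filterlim_tendsto_pos_mult_at_top[OF tendsto_const])
  then have "((\<lambda>x. m / (p + (q * f1 x + (r * f2 x + t * f12 x)))) \<longlongrightarrow> 0) F"
    by (intro tendsto_divide_0[OF tendsto_const] filterlim_at_top_imp_at_infinity)
  moreover have "((\<lambda>x. p + q / f1 x + r / f2 x + t / f12 x) \<longlongrightarrow> p + 0 + 0 + 0) F"
    using inf by (intro tendsto_add tendsto_const tendsto_divide_0[OF tendsto_const])
  then have "((\<lambda>x. 1 - (1 - m) / (p + q / f1 x + r / f2 x + t / f12 x)) \<longlongrightarrow> 1 - (1 - m) / (p + 0 + 0 + 0)) F"
    using pos by (intro tendsto_diff tendsto_divide tendsto_const) auto
  ultimately show ?thesis
    unfolding bound_at_def defs[symmetric] by (auto intro!: tendsto_max simp: add.assoc)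
qed

section \<open>Monotonicity and limits of the bias factor\<close>

lemma bias_pos: "1 \<le> R \<Longrightarrow> 1 \<le> RY \<Longrightarrow> 0 < bias R RY"
  by (simp add: bias_def)

lemma bias_commute: "bias R RY = bias RY R"
  by (simp add: bias_def algebra_simps)

lemma bias_1: "1 \<le> R \<Longrightarrow> bias R 1 = 1"
  by (simp add: bias_def)

text \<open>The difference has the numerator \<open>RY * (RY - 1) * (R' - R)\<close>. At
  \<open>RY = 1\<close> it vanishes, hence the strict condition on \<open>RY\<close>.\<close>

lemma bias_strict_mono_left:
  assumes "1 \<le> R" "R < R'" "1 < RY"
  shows "bias R RY < bias R' RY"
proof -
  have "bias R' RY - bias R RY = RY * (RY - 1) * (R' - R) / ((R + RY - 1) * (R' + RY - 1))"
    using assms by (simp add: bias_def diff_frac_eq) (simp add: algebra_simps)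
  also have "\<dots> > 0"
    using assms by simp
  finally show ?thesis by simp
qed

text \<open>The arguments are raised one after the other, the second by symmetry. The case
  \<open>RY = 1\<close> is split off because \<open>bias\<close> is constantly 1 there.\<close>

lemma bias_mono:
  assumes "1 \<le> R" "R \<le> R'" "1 \<le> RY" "RY \<le> RY'"
  shows "bias R RY \<le> bias R' RY'"
proof -
  have left: "bias R RY \<le> bias R' RY" if "1 \<le> R" "R \<le> R'" "1 \<le> RY" for R R' RY
    using that bias_strict_mono_left[of R R' RY] by (cases "R = R' \<or> RY = 1") (auto simp: bias_1)
  have "bias R RY \<le> bias R' RY"
    using assms by (intro left)
  also have "\<dots> \<le> bias R' RY'"
    using assms left[of RY RY' R'] by (simp add: bias_commute)
  finally show ?thesis .
qed

text \<open>The first argument is raised last, at the outcome risk \<open>RY'\<close>, which exceeds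
  1 even if \<open>RY = 1\<close>; this is where strictness arises.\<close>

lemma bias_strict_mono:
  assumes "1 \<le> R" "R < R'" "1 \<le> RY" "RY < RY'"
  shows "bias R RY < bias R' RY'"
  using assms bias_mono[of R R RY RY'] bias_strict_mono_left[of R R' RY'] by simp

text \<open>Clearing the denominator and cancelling \<open>R\<close> leaves
  \<open>1 < R\<close>.\<close>

lemma bias_less_left:
  assumes "1 < R" "1 \<le> RY"
  shows "bias R RY < R"
  using assms by (simp add: bias_def divide_less_eq)

lemma bias_le_left:
  assumes "1 \<le> R" "1 \<le> RY"
  shows "bias R RY \<le> R"
  using assms by (simp add: bias_def divide_le_eq)

lemma bias_le_right: "1 \<le> R \<Longrightarrow> 1 \<le> RY \<Longrightarrow> bias R RY \<le> RY"
  using bias_le_left[of RY R] by (simp add: bias_commute)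

lemma bias_tendsto_left: "0 < R \<Longrightarrow> ((\<lambda>RY. bias R RY) \<longlongrightarrow> R) at_top"
  unfolding bias_def by real_asymp

text \<open>A general \<open>f\<close> is allowed because the limit in the selection risk must also
  cover the product of the two selection risks.\<close>

lemma bias_tendsto_right:
  assumes "0 < RY" "filterlim f at_top F"
  shows "((\<lambda>x. bias (f x) RY) \<longlongrightarrow> RY) F"
  using filterlim_compose[OF bias_tendsto_left[OF assms(1)] assms(2)] by (simp add: bias_commute)

section \<open>Existence, order and necessity of the thresholds\<close>

text \<open>The intermediate value theorem gives a root and strict monotonicity its uniqueness. The
  sublevel set is then a half-line, so a value at most \<open>c\<close> translates into a comparison
  with \<open>g\<close>.\<close>

lemma strict_antimono_crossing:
  fixes f :: "real \<Rightarrow> real"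
  assumes "continuous_on {a..} f"
    and anti: "\<And>x y. a \<le> x \<Longrightarrow> x < y \<Longrightarrow> f y < f x"
    and "c < f a" and "(f \<longlongrightarrow> l) at_top" "l < c"
  obtains g where "a < g" "f g = c" "\<And>x. a \<le> x \<Longrightarrow> f x \<le> c \<longleftrightarrow> g \<le> x"
    "\<And>x. a \<le> x \<Longrightarrow> f x = c \<longleftrightarrow> x = g"
proof -
  \<comment> \<open>A limit below \<open>c\<close> supplies a finite right endpoint \<open>b\<close>
    for the intermediate value theorem.\<close>
  have "\<forall>\<^sub>F x in at_top. f x < c \<and> a \<le> x"
    using order_tendstoD(2)[OF assms(4,5)] eventually_ge_at_top by (rule eventually_conj)
  then obtain b where b: "f b < c" "a \<le> b"
    using eventually_happens by fastforce
  have "continuous_on {a..b} f"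
    using assms(1) by (rule continuous_on_subset) auto
  then obtain g where g: "a \<le> g" "f g = c"
    using IVT2'[of f b c a] b assms(3) by auto
  have "a < g"
    using g assms(3) by (cases "a = g") auto
  moreover have "f x \<le> c \<longleftrightarrow> g \<le> x" if "a \<le> x" for x
    using anti[of x g] anti[of g x] g that by (cases x g rule: linorder_cases) auto
  moreover have "f x = c \<longleftrightarrow> x = g" if "a \<le> x" for x
    using anti[of x g] anti[of g x] g that by (cases x g rule: linorder_cases) auto
  ultimately show thesis
    using that g(2) by blast
qed

text \<open>The curve starts at the factors \<open>(1, 1, 1)\<close>, where the bound is
  \<open>m\<close>, and runs off to the worst case. Two functions suffice, since equal selection
  risks make the first two factors equal. The worst-case value must be strictly below
  \<open>c\<close>, as a strictly decreasing function never attains its limit.\<close>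

lemma bound_at_crossing:
  fixes \<beta>1 \<beta>2 :: "real \<Rightarrow> real"
  assumes "0 < m" "m < 1" "w1 \<in> {0<..<1}" "w2 \<in> {0<..<1}"
    and "c < m" "max 0 (1 - (1 - m) / (w1 * w2)) < c"
    and cont: "continuous_on {1..} \<beta>1" "continuous_on {1..} \<beta>2"
    and mono: "\<And>x y. 1 \<le> x \<Longrightarrow> x < y \<Longrightarrow> \<beta>1 x < \<beta>1 y" "\<And>x y. 1 \<le> x \<Longrightarrow> x < y \<Longrightarrow> \<beta>2 x < \<beta>2 y"
    and one: "\<beta>1 1 = 1" "\<beta>2 1 = 1"
    and lim: "filterlim \<beta>1 at_top at_top" "filterlim \<beta>2 at_top at_top"
  obtains g where "1 < g" "bound_at m w1 w2 (\<beta>1 g) (\<beta>1 g) (\<beta>2 g) = c"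
    "\<And>x. 1 \<le> x \<Longrightarrow> bound_at m w1 w2 (\<beta>1 x) (\<beta>1 x) (\<beta>2 x) \<le> c \<longleftrightarrow> g \<le> x"
    "\<And>x. 1 \<le> x \<Longrightarrow> bound_at m w1 w2 (\<beta>1 x) (\<beta>1 x) (\<beta>2 x) = c \<longleftrightarrow> x = g"
proof (rule strict_antimono_crossing[of 1 "\<lambda>x. bound_at m w1 w2 (\<beta>1 x) (\<beta>1 x) (\<beta>2 x)" c])
  have pos: "0 < \<beta>1 x" "0 < \<beta>2 x" if "1 \<le> x" for x
    using that mono(1)[of 1 x] mono(2)[of 1 x] one by (cases "x = 1"; simp)+
  show "continuous_on {1..} (\<lambda>x. bound_at m w1 w2 (\<beta>1 x) (\<beta>1 x) (\<beta>2 x))"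
    using cont assms(3,4) pos unfolding continuous_on_def
    by (intro ballI bound_at_tendsto) auto
  show "bound_at m w1 w2 (\<beta>1 y) (\<beta>1 y) (\<beta>2 y) < bound_at m w1 w2 (\<beta>1 x) (\<beta>1 x) (\<beta>2 x)"
    if "1 \<le> x" "x < y" for x y
    using that assms(1-4) pos mono by (intro bound_at_strict_antimono) (auto intro: less_imp_le)
  show "c < bound_at m w1 w2 (\<beta>1 1) (\<beta>1 1) (\<beta>2 1)"
    using assms(5) by (simp add: one bound_at_1)
  show "((\<lambda>x. bound_at m w1 w2 (\<beta>1 x) (\<beta>1 x) (\<beta>2 x)) \<longlongrightarrow> max 0 (1 - (1 - m) / (w1 * w2))) at_top"
    using assms(3,4) lim by (intro bound_at_tendsto_at_top)
qed (use assms(6) that in auto)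

text \<open>The risks are quantified after the thresholds, which depend only on \<open>m\<close>,
  \<open>w1\<close>, \<open>w2\<close> and \<open>c\<close>. Equations with singletons express
  existence and uniqueness of the roots together.\<close>

lemma lower_bound_thresholds:
  assumes m: "0 < m" "m < 1" and w: "w1 \<in> {0<..<1}" "w2 \<in> {0<..<1}"
    and c: "c < m" "max 0 (1 - (1 - m) / (w1 * w2)) < c"
  obtains gS gY G where "1 < gS" "gS < gY" "gY < G"
    "{g \<in> {1<..}. ((\<lambda>\<rho>. lower_bound m w1 w2 g g \<rho>) \<longlongrightarrow> c) at_top} = {gS}"
    "{g \<in> {1<..}. ((\<lambda>\<rho>. lower_bound m w1 w2 \<rho> \<rho> g) \<longlongrightarrow> c) at_top} = {gY}"
    "{g \<in> {1<..}. lower_bound m w1 w2 g g g = c} = {G}"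
    "\<forall>R1\<ge>1. \<forall>R2\<ge>1. \<forall>RY\<ge>1. lower_bound m w1 w2 R1 R2 RY \<le> c \<longrightarrow>
       gS \<le> max R1 R2 \<and> gY \<le> RY \<and> G \<le> max (max R1 R2) RY"
proof -
  have sq: "x * x < y * y" if "1 \<le> x" "x < y" for x y :: real
    using that by (intro mult_strict_mono) auto
  have ge: "1 \<le> x * x" if "1 \<le> x" for x :: real
    using mult_mono[of 1 x 1 x] that by simp
  have lim: "filterlim (\<lambda>x::real. x * x) at_top at_top"
    "filterlim (\<lambda>x. bias x x) at_top at_top" "filterlim (\<lambda>x. bias (x * x) x) at_top at_top"
    unfolding bias_def by real_asymp+
  have cont: "continuous_on {1..} (\<lambda>x. bias x x)" "continuous_on {1..} (\<lambda>x. bias (x * x) x)"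
    unfolding bias_def by (intro continuous_intros; use ge in fastforce)+
  obtain gS where gS: "1 < gS" "bound_at m w1 w2 gS gS (gS * gS) = c"
      "\<And>x. 1 \<le> x \<Longrightarrow> bound_at m w1 w2 x x (x * x) \<le> c \<longleftrightarrow> gS \<le> x"
      "\<And>x. 1 \<le> x \<Longrightarrow> bound_at m w1 w2 x x (x * x) = c \<longleftrightarrow> x = gS"
    by (rule bound_at_crossing[OF m w c, of "\<lambda>x. x" "\<lambda>x. x * x"])
      (auto intro!: continuous_intros sq lim filterlim_ident)
  obtain gY where gY: "1 < gY" "bound_at m w1 w2 gY gY gY = c"
      "\<And>x. 1 \<le> x \<Longrightarrow> bound_at m w1 w2 x x x \<le> c \<longleftrightarrow> gY \<le> x"
      "\<And>x. 1 \<le> x \<Longrightarrow> bound_at m w1 w2 x x x = c \<longleftrightarrow> x = gY"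
    by (rule bound_at_crossing[OF m w c, of "\<lambda>x. x" "\<lambda>x. x"])
      (auto intro!: continuous_intros filterlim_ident)
  obtain G where G: "1 < G" "bound_at m w1 w2 (bias G G) (bias G G) (bias (G * G) G) = c"
      "\<And>x. 1 \<le> x \<Longrightarrow> bound_at m w1 w2 (bias x x) (bias x x) (bias (x * x) x) \<le> c \<longleftrightarrow> G \<le> x"
      "\<And>x. 1 \<le> x \<Longrightarrow> bound_at m w1 w2 (bias x x) (bias x x) (bias (x * x) x) = c \<longleftrightarrow> x = G"
    by (rule bound_at_crossing[OF m w c, of "\<lambda>x. bias x x" "\<lambda>x. bias (x * x) x"])
      (auto intro!: bias_strict_mono sq lim cont ge simp: bias_1)
  \<comment> \<open>The first curve is already below \<open>c\<close> at \<open>gY\<close>, so it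
    crosses \<open>c\<close> strictly earlier.\<close>
  have "bound_at m w1 w2 gY gY (gY * gY) < bound_at m w1 w2 gY gY gY"
    using gY(1) by (intro bound_at_strict_antimono[OF m w]) auto
  then have "gS < gY"
    using gS(3)[of gY] gS(4)[of gY] gY(1,2) by auto
  \<comment> \<open>With its arguments swapped, \<open>bias_less_left\<close> puts
    \<open>bias (G * G) G\<close> strictly below \<open>G\<close>; the other two factors need only
    the weak inequality.\<close>
  have "bound_at m w1 w2 G G G < bound_at m w1 w2 (bias G G) (bias G G) (bias (G * G) G)"
    using G(1) ge[of G] bias_less_left[of G "G * G"]
    by (intro bound_at_strict_antimono[OF m w])
      (auto intro: bias_pos bias_le_left simp: bias_commute[of "G * G"])
  then have "gY < G"
    using gY(3)[of G] gY(4)[of G] G(1,2) by auto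
  have limS: "((\<lambda>\<rho>. lower_bound m w1 w2 g g \<rho>) \<longlongrightarrow> bound_at m w1 w2 g g (g * g)) at_top"
    if "1 < g" for g
    unfolding lower_bound_eq_bound_at using that w
    by (intro bound_at_tendsto bias_tendsto_left) auto
  have limY: "((\<lambda>\<rho>. lower_bound m w1 w2 \<rho> \<rho> g) \<longlongrightarrow> bound_at m w1 w2 g g g) at_top" if "1 < g" for g
    unfolding lower_bound_eq_bound_at using that w lim(1)
    by (intro bound_at_tendsto bias_tendsto_right filterlim_ident) auto
  \<comment> \<open>Limits along \<open>at_top\<close> are unique, so converging to \<open>c\<close>
    means that the known limit equals \<open>c\<close>.\<close>
  have "{g \<in> {1<..}. ((\<lambda>\<rho>. lower_bound m w1 w2 g g \<rho>) \<longlongrightarrow> c) at_top}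
      = {g \<in> {1<..}. bound_at m w1 w2 g g (g * g) = c}"
    using limS tendsto_unique[OF trivial_limit_at_top_linorder limS] by auto
  also have "\<dots> = {gS}"
    using gS(1) gS(4)[OF less_imp_le] by auto
  finally have S: "{g \<in> {1<..}. ((\<lambda>\<rho>. lower_bound m w1 w2 g g \<rho>) \<longlongrightarrow> c) at_top} = {gS}" .
  have "{g \<in> {1<..}. ((\<lambda>\<rho>. lower_bound m w1 w2 \<rho> \<rho> g) \<longlongrightarrow> c) at_top}
      = {g \<in> {1<..}. bound_at m w1 w2 g g g = c}"
    using limY tendsto_unique[OF trivial_limit_at_top_linorder limY] by auto
  also have "\<dots> = {gY}"
    using gY(1) gY(4)[OF less_imp_le] by auto
  finally have Y: "{g \<in> {1<..}. ((\<lambda>\<rho>. lower_bound m w1 w2 \<rho> \<rho> g) \<longlongrightarrow> c) at_top} = {gY}" .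
  have GG: "{g \<in> {1<..}. lower_bound m w1 w2 g g g = c} = {G}"
    unfolding lower_bound_eq_bound_at using G(1) G(4)[OF less_imp_le] by auto
  have nullify: "gS \<le> max R1 R2 \<and> gY \<le> RY \<and> G \<le> max (max R1 R2) RY"
    if R: "1 \<le> R1" "1 \<le> R2" "1 \<le> RY" and le: "lower_bound m w1 w2 R1 R2 RY \<le> c" for R1 R2 RY
  proof -
    have R12: "1 \<le> R1 * R2"
      using mult_mono[of 1 R1 1 R2] R by simp
    \<comment> \<open>Raising the actual factors keeps the bound at most \<open>c\<close>. This is
      applied three times: letting the outcome risk go to infinity, letting the selection risks go
      to infinity, and replacing all three risks by their maximum \<open>T\<close>.\<close>
    have below: "bound_at m w1 w2 b b b12 \<le> c"
      if "bias R1 RY \<le> b" "bias R2 RY \<le> b" "bias (R1 * R2) RY \<le> b12" for b b12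
      using bound_at_antimono[OF m w, of "bias R1 RY" b "bias R2 RY" b "bias (R1 * R2) RY" b12]
        that R R12 le by (simp add: lower_bound_eq_bound_at bias_pos)
    define R where "R = max R1 R2"
    define T where "T = max R RY"
    have max: "1 \<le> R" "R1 \<le> R" "R2 \<le> R" "1 \<le> T" "R \<le> T" "RY \<le> T"
      using R by (auto simp: R_def T_def)
    have RR: "R1 * R2 \<le> R * R" "R1 * R2 \<le> T * T"
      using R max by (auto intro!: mult_mono)
    have "bound_at m w1 w2 R R (R * R) \<le> c"
      using bias_le_left[of R1 RY] bias_le_left[of R2 RY] bias_le_left[OF R12, of RY] R R12 max RR
      by (intro below) auto
    moreover have "bound_at m w1 w2 RY RY RY \<le> c"
      using R R12 by (intro below bias_le_right)
    moreover have "bound_at m w1 w2 (bias T T) (bias T T) (bias (T * T) T) \<le> c"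
      using R R12 max RR by (intro below bias_mono) auto
    ultimately have "gS \<le> R" "gY \<le> RY" "G \<le> T"
      using gS(3)[OF max(1)] gY(3)[OF R(3)] G(3)[OF max(4)] by blast+
    then show ?thesis
      by (simp add: R_def T_def)
  qed
  show thesis
    by (rule that[OF gS(1) \<open>gS < gY\<close> \<open>gY < G\<close> S Y GG]) (use nullify in blast)
qed

section \<open>Conditional laws and the range of the weights\<close>

lemma valid_dgpD:
  assumes "valid_dgp M" "x \<in> space (cov_space M)"
  shows "prob_space (given M x)" "sets (given M x) = sets (law M)"
    "treat M \<in> given M x \<rightarrow>\<^sub>M count_space UNIV" "pot_D M z \<in> given M x \<rightarrow>\<^sub>M count_space UNIV"
    "pot_Y M z \<in> given M x \<rightarrow>\<^sub>M out_space M"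
proof -
  have "given M x \<in> space (prob_algebra (law M))"
    using assms unfolding valid_dgp_def by (meson measurable_space)
  then show 1: "prob_space (given M x)" and 2: "sets (given M x) = sets (law M)"
    by (auto simp: space_prob_algebra)
  show "treat M \<in> given M x \<rightarrow>\<^sub>M count_space UNIV" "pot_D M z \<in> given M x \<rightarrow>\<^sub>M count_space UNIV"
    "pot_Y M z \<in> given M x \<rightarrow>\<^sub>M out_space M"
    using assms(1) unfolding measurable_cong_sets[OF 2 refl] by (auto simp: valid_dgp_def)
qed

text \<open>On \<open>treat M \<omega> = z\<close> the observed intermediate is
  \<open>pot_D M z \<omega>\<close>. Ignorability factors the joint probability, and positivity lets
  the treatment probability cancel.\<close>

lemma D_prob_eq:
  assumes "valid_dgp M" "treatment_ignorability M" "x \<in> space (cov_space M)"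
    and pos: "\<P>(\<omega> in given M x. treat M \<omega> = z) > 0"
  shows "D_prob M z x = \<P>(\<omega> in given M x. pot_D M z \<omega>)"
proof -
  let ?P = "given M x"
  interpret prob_space ?P
    using assms by (simp add: valid_dgpD)
  define f where "f = (\<lambda>\<omega>. (pot_D M False \<omega>, pot_D M True \<omega>, pot_Y M False \<omega>, pot_Y M True \<omega>))"
  define N where "N = (count_space UNIV \<Otimes>\<^sub>M count_space UNIV \<Otimes>\<^sub>M out_space M \<Otimes>\<^sub>M out_space M
    :: (bool \<times> bool \<times> 'c \<times> 'c) measure)"
  \<comment> \<open>This cylinder follows the tuple order of the ignorability assumption, in which
    the potential intermediate under \<open>False\<close> comes first.\<close>
  define B where "B = {v \<in> space N. (if z then fst (snd v) else fst v)}"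
  have f: "f \<in> ?P \<rightarrow>\<^sub>M N"
    unfolding f_def N_def using valid_dgpD[OF assms(1,3)] by measurable
  have "B \<in> sets N"
    unfolding B_def N_def by (cases z) simp_all
  moreover have "indep_set {treat M -` A \<inter> space ?P | A. True} {f -` B \<inter> space ?P | B. B \<in> sets N}"
    using assms(2,3) unfolding treatment_ignorability_def f_def N_def by blast
  ultimately have "prob ((treat M -` {z} \<inter> space ?P) \<inter> (f -` B \<inter> space ?P))
      = prob (treat M -` {z} \<inter> space ?P) * prob (f -` B \<inter> space ?P)"
    by (intro indep_setD) auto
  moreover have "f -` B \<inter> space ?P = {\<omega> \<in> space ?P. pot_D M z \<omega>}"
    using measurable_space[OF f] by (cases z) (auto simp: B_def f_def)
  moreover have "treat M -` {z} \<inter> space ?P = {\<omega> \<in> space ?P. treat M \<omega> = z}"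
    by auto
  moreover have "{\<omega> \<in> space ?P. treat M \<omega> = z} \<inter> {\<omega> \<in> space ?P. pot_D M z \<omega>}
      = {\<omega> \<in> space ?P. obs_D M \<omega> \<and> treat M \<omega> = z}"
    by (auto simp: obs_D_def)
  ultimately show ?thesis
    using pos by (simp add: D_prob_def cond_prob_def)
qed

text \<open>The stratum events of a cell partition the event that the potential intermediate under
  \<open>z\<close> is \<open>d\<close>.\<close>

lemma sum_stratum_prob_cell:
  assumes "valid_dgp M" "x \<in> space (cov_space M)"
  shows "(\<Sum>s\<in>cell z d. stratum_prob M s x) = \<P>(\<omega> in given M x. pot_D M z \<omega> = d)"
proof -
  let ?P = "given M x"
  interpret prob_space ?P
    using assms by (simp add: valid_dgpD)
  note [measurable] = valid_dgpD(4)[OF assms]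
  let ?S = "\<lambda>s. {\<omega> \<in> space ?P. stratum M \<omega> = s}"
  have "?S s \<in> events" for s
    unfolding stratum_def by (cases s) simp
  then have "?S ` cell z d \<subseteq> events"
    by blast
  moreover have "disjoint_family_on ?S (cell z d)"
    by (auto simp only: disjoint_family_on_def)
  moreover have "finite (cell z d)"
    by (cases z; cases d) auto
  ultimately have "prob (\<Union>s\<in>cell z d. ?S s) = (\<Sum>s\<in>cell z d. prob (?S s))"
    by (intro finite_measure_finite_Union)
  moreover have "(\<Union>s\<in>cell z d. ?S s) = {\<omega> \<in> space ?P. pot_D M z \<omega> = d}"
    by (cases z; cases d) (auto simp: stratum_def)
  ultimately show ?thesis
    by (simp add: stratum_prob_def)
qed

text \<open>For either value of \<open>d\<close> the denominator is the total probability of the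
  cell. The weight is thus the share of one of two strata, both of positive probability.\<close>

lemma weight_bounds:
  assumes "valid_dgp M" "treatment_ignorability M" "x \<in> space (cov_space M)"
    and pos: "cell_positivity M z d x" and s: "s \<in> cell z d"
  shows "weight M z d s x \<in> {0<..<1}"
proof -
  let ?P = "given M x"
  interpret prob_space ?P
    using assms by (simp add: valid_dgpD)
  note [measurable] = valid_dgpD(4)[OF assms(1,3)]
  have "D_prob M z x = prob {\<omega> \<in> space ?P. pot_D M z \<omega>}"
    using assms by (intro D_prob_eq) (auto simp: cell_positivity_def)
  moreover have "prob {\<omega> \<in> space ?P. \<not> pot_D M z \<omega>} = 1 - prob {\<omega> \<in> space ?P. pot_D M z \<omega>}"
    by (intro prob_neg) measurable
  ultimately have w: "weight M z d s x = stratum_prob M s x / (\<Sum>s'\<in>cell z d. stratum_prob M s' x)"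
    by (cases d) (simp_all add: weight_def sum_stratum_prob_cell[OF assms(1,3)])
  obtain s' where s': "cell z d = {s, s'}" "s \<noteq> s'"
    using s by (cases z; cases d) auto
  then show ?thesis
    using pos w by (simp add: cell_positivity_def)
qed


section \<open>Transfer to the data-generating process\<close>

theorem theorem4:
  fixes M :: "('w, 'x, 'y, 'u::countable) dgp"
    and \<theta> :: "'x \<Rightarrow> ennreal"
    and h :: "'y \<Rightarrow> 'y \<Rightarrow> real"
    and z1 z2 d1 d2 :: bool
    and s :: stratum
    and x1 x2 :: 'x
    and c0 :: real
  assumes "valid_dgp M"
    and "contrast M h"
    and "treatment_ignorability M"
    and "latent_principal_ignorability M"
    and "odds_ratio_assumption M \<theta>"
    and "x1 \<in> space (cov_space M)" and "x2 \<in> space (cov_space M)"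
    and "cell_positivity M z1 d1 x1" and "cell_positivity M z2 d2 x2"
    and "RR_SU M z1 d1 x1 \<in> {1..<\<infinity>}" and "RR_SU M z2 d2 x2 \<in> {1..<\<infinity>}"
    and "RR_UY M h z1 z2 x1 x2 \<in> {1..<\<infinity>}"
    and "z1 \<noteq> z2"
    and "s \<in> cell z1 d1 \<inter> cell z2 d2"
    and "c0 \<in> {0..<1}"
    and "obs_mean M h z1 z2 d1 d2 x1 x2 > c0"
    and "L_GM M h z1 z2 d1 d2 s x1 x2 < c0"
  shows "\<exists>\<gamma>SU \<gamma>UY \<Gamma> :: real.
     1 < \<gamma>SU \<and> \<gamma>SU < \<gamma>UY \<and> \<gamma>UY < \<Gamma> \<and>
     {g \<in> {1<..}. ((\<lambda>\<rho>UY. L_param M h z1 z2 d1 d2 s x1 x2 g \<rho>UY) \<longlongrightarrow> c0) at_top} = {\<gamma>SU} \<and>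
     {g \<in> {1<..}. ((\<lambda>\<rho>SU. L_param M h z1 z2 d1 d2 s x1 x2 \<rho>SU g) \<longlongrightarrow> c0) at_top} = {\<gamma>UY} \<and>
     {g \<in> {1<..}. L_param M h z1 z2 d1 d2 s x1 x2 g g = c0} = {\<Gamma>} \<and>
     (L_bound M h z1 z2 d1 d2 s x1 x2 \<le> c0 \<longrightarrow>
        max (RR_SU M z1 d1 x1) (RR_SU M z2 d2 x2) \<ge> ennreal \<gamma>SU \<and>
        RR_UY M h z1 z2 x1 x2 \<ge> ennreal \<gamma>UY \<and>
        max (max (RR_SU M z1 d1 x1) (RR_SU M z2 d2 x2)) (RR_UY M h z1 z2 x1 x2) \<ge> ennreal \<Gamma>)"
proof -
  define m w1 w2 where "m = obs_mean M h z1 z2 d1 d2 x1 x2"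
    and "w1 = weight M z1 d1 s x1" and "w2 = weight M z2 d2 s x2"
  have w: "w1 \<in> {0<..<1}" "w2 \<in> {0<..<1}"
    using assms unfolding w1_def w2_def by (auto intro!: weight_bounds simp del: greaterThanLessThan_iff)
  have L: "c0 < m" "max 0 (1 - (1 - m) / (w1 * w2)) < c0"
    using assms by (simp_all add: m_def w1_def w2_def L_GM_def)
  \<comment> \<open>A maximum with 0 lies below \<open>c0\<close>, so \<open>0 < c0 < m\<close>. Its
    other branch lies below \<open>c0 < 1\<close>, which forces \<open>m < 1\<close>.\<close>
  then have "0 < m"
    by simp
  have "0 < (1 - m) / (w1 * w2)"
    using L \<open>c0 \<in> {0..<1}\<close> by simp
  then have "m < 1"
    using w pos_less_divide_eq[of "w1 * w2" 0 "1 - m"] by simp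
  define R1 R2 RY where "R1 = enn2real (RR_SU M z1 d1 x1)" and "R2 = enn2real (RR_SU M z2 d2 x2)"
    and "RY = enn2real (RR_UY M h z1 z2 x1 x2)"
  \<comment> \<open>Finiteness matters here: \<open>enn2real\<close> sends infinity to 0, so only
    finite risks survive the passage to the reals and back.\<close>
  have real: "1 \<le> enn2real a \<and> a = ennreal (enn2real a)" if "a \<in> {1..<\<infinity>}" for a
    using that by (cases a) auto
  have R: "1 \<le> R1" "1 \<le> R2" "1 \<le> RY" "RR_SU M z1 d1 x1 = ennreal R1"
    "RR_SU M z2 d2 x2 = ennreal R2" "RR_UY M h z1 z2 x1 x2 = ennreal RY"
    unfolding R1_def R2_def RY_def using assms(10-12) by (auto simp only: real)
  obtain gS gY G where G: "1 < gS" "gS < gY" "gY < G"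
    "{g \<in> {1<..}. ((\<lambda>\<rho>. lower_bound m w1 w2 g g \<rho>) \<longlongrightarrow> c0) at_top} = {gS}"
    "{g \<in> {1<..}. ((\<lambda>\<rho>. lower_bound m w1 w2 \<rho> \<rho> g) \<longlongrightarrow> c0) at_top} = {gY}"
    "{g \<in> {1<..}. lower_bound m w1 w2 g g g = c0} = {G}"
    and nullify: "\<forall>R1\<ge>1. \<forall>R2\<ge>1. \<forall>RY\<ge>1. lower_bound m w1 w2 R1 R2 RY \<le> c0 \<longrightarrow>
       gS \<le> max R1 R2 \<and> gY \<le> RY \<and> G \<le> max (max R1 R2) RY"
    by (rule lower_bound_thresholds[OF \<open>0 < m\<close> \<open>m < 1\<close> w L]) (rule that)
  have L_bound: "L_bound M h z1 z2 d1 d2 s x1 x2 = lower_bound m w1 w2 R1 R2 RY"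
    by (simp add: L_bound_def m_def w1_def w2_def R1_def R2_def RY_def)
  have L_param: "L_param M h z1 z2 d1 d2 s x1 x2 = (\<lambda>\<rho>SU \<rho>UY. lower_bound m w1 w2 \<rho>SU \<rho>SU \<rho>UY)"
    by (simp add: L_param_def m_def w1_def w2_def fun_eq_iff)
  have "ennreal gS \<le> max (ennreal R1) (ennreal R2) \<and> ennreal gY \<le> ennreal RY \<and>
      ennreal G \<le> max (max (ennreal R1) (ennreal R2)) (ennreal RY)"
    if "lower_bound m w1 w2 R1 R2 RY \<le> c0"
    using nullify[rule_format, OF R(1-3) that] by (auto simp: le_max_iff_disj intro: ennreal_leI)
  then show ?thesis
    unfolding L_bound L_param R(4-6) using G by blast
qed

end
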